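(* Let $X$ be a weakly Lindelöf determined (WLD) Banach space with $\omega_1\leq\mathrm{dens}\,X\leq\mathfrak{c}$. Then there exist two dense linear subspaces $Y$ and $Z$ of $X$ such that no non-separable linear subspace of $Y$ is linearly isomorphic to a linear subspace of $Z$, and no non-separable linear subspace of $Z$ is linearly isomorphic to a linear subspace of $Y$. In particular, $Y$ and $Z$ are not densely isomorphic.
   Context: "Subspace" means linear subspace, not necessarily closed. $\mathfrak{c}$ is the cardinality of the continuum and $\mathrm{dens}\,X$ is the density character of $X$. Normed spaces are linearly isomorphic if there is a linear bijection between them that is bounded with bounded inverse. Two normed spaces $Y$ and $Z$ are densely isomorphic if there exist dense linear subspaces $Y_0$ of $Y$ and $Z_0$ of $Z$ that are linearly isomorphic. A biorthogonal system for a Banach space $X$ is a family $\{x_\gamma;x_\gamma^*\}_{\gamma\in\Gamma}\subseteq X\times X^*$ with $\langle x_\alpha^*,x_\beta\rangle=\delta_{\alpha,\beta}$ for all $\alpha,\beta\in\Gamma$. It is an M-basis for $X$ if moreover $\overline{\mathrm{span}}\{x_\gamma\}_{\gamma\in\Gamma}=X$ and $\overline{\mathrm{span}}^{w^*}\{x_\gamma^*\}_{\gamma\in\Gamma}=X^*$. A Banach space $X$ is weakly Lindelöf determined (WLD) if it admits an M-basis $\{x_\gamma;x_\gamma^*\}_{\gamma\in\Gamma}$ such that for every $x^*\in X^*$ the set $\{\gamma\in\Gamma:\langle x^*,x_\gamma\rangle\neq0\}$ is countable. *)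

theory Defs
  imports "HOL-Analysis.Analysis"
begin

unbundle cardinal_syntax

definition dense_in_topology :: "'a topology \<Rightarrow> 'a set \<Rightarrow> bool" where
  "dense_in_topology T D \<longleftrightarrow> D \<subseteq> topspace T \<and> T closure_of D = topspace T"

text \<open>The density character is the least cardinality of a dense subset, as a cardinal order in
  the sense of the BNF cardinal theory; the choice is immaterial up to \<open>=o\<close>, see
  \<open>density_character_eqI\<close>.\<close>

definition density_character :: "'a topology \<Rightarrow> 'a rel" where
  "density_character T =
     |SOME D. dense_in_topology T D \<and> (\<forall>E. dense_in_topology T E \<longrightarrow> |D| \<le>o |E| )|"

lemma density_character_witness:
  "\<exists>D. dense_in_topology T D \<and> density_character T = |D| \<and>
       (\<forall>E. dense_in_topology T E \<longrightarrow> |D| \<le>o |E| )"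
proof -
  let ?R = "card_of ` {D. dense_in_topology T D}"
  have "dense_in_topology T (topspace T)"
    by (simp add: dense_in_topology_def)
  then have "?R \<noteq> {}" by blast
  moreover have "\<forall>r\<in>?R. Card_order r"
    by (auto simp: card_of_Card_order)
  ultimately obtain r where "r \<in> ?R" "\<forall>r'\<in>?R. r \<le>o r'"
    using exists_minim_Card_order[of ?R] by blast
  then have "\<exists>D. dense_in_topology T D \<and> (\<forall>E. dense_in_topology T E \<longrightarrow> |D| \<le>o |E| )"
    by blast
  from someI_ex[OF this] show ?thesis
    unfolding density_character_def by blast
qed

lemma density_character_eqI:
  assumes "dense_in_topology T D" "\<And>E. dense_in_topology T E \<Longrightarrow> |D| \<le>o |E|"
  shows "density_character T =o |D|"
  using density_character_witness[of T] assms by (metis ordIso_iff_ordLeq)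

text \<open>The dual of a real Banach space \<open>'a\<close> is the type \<open>'a \<Rightarrow>\<^sub>L real\<close>. Its strong operator
  topology is the topology of pointwise convergence on \<open>'a\<close>, which for scalar-valued operators
  is the weak-star topology.\<close>

abbreviation weak_star_topology :: "('a::real_normed_vector \<Rightarrow>\<^sub>L real) topology" where
  "weak_star_topology \<equiv> strong_operator_topology"

definition biorthogonal_system ::
    "'i set \<Rightarrow> ('i \<Rightarrow> 'a::real_normed_vector) \<Rightarrow> ('i \<Rightarrow> 'a \<Rightarrow>\<^sub>L real) \<Rightarrow> bool" where
  "biorthogonal_system \<Gamma> x f \<longleftrightarrow>
     (\<forall>\<alpha>\<in>\<Gamma>. \<forall>\<beta>\<in>\<Gamma>. blinfun_apply (f \<alpha>) (x \<beta>) = (if \<alpha> = \<beta> then 1 else 0))"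

definition M_basis ::
    "'i set \<Rightarrow> ('i \<Rightarrow> 'a::real_normed_vector) \<Rightarrow> ('i \<Rightarrow> 'a \<Rightarrow>\<^sub>L real) \<Rightarrow> bool" where
  "M_basis \<Gamma> x f \<longleftrightarrow> biorthogonal_system \<Gamma> x f
     \<and> closure (span (x ` \<Gamma>)) = UNIV
     \<and> weak_star_topology closure_of (span (f ` \<Gamma>)) = UNIV"

text \<open>The vectors of a biorthogonal system are pairwise distinct, so taking index sets inside
  the type \<open>'a\<close> is no restriction: \<open>weakly_Lindelof_determinedI\<close> admits arbitrary index types.\<close>

definition weakly_Lindelof_determined :: "'a::banach itself \<Rightarrow> bool" where
  "weakly_Lindelof_determined _ \<longleftrightarrow>
     (\<exists>(\<Gamma> :: 'a set) (x :: 'a \<Rightarrow> 'a) f. M_basis \<Gamma> x f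
        \<and> (\<forall>g :: 'a \<Rightarrow>\<^sub>L real. countable {\<gamma>\<in>\<Gamma>. blinfun_apply g (x \<gamma>) \<noteq> 0}))"

lemma weakly_Lindelof_determinedI:
  fixes \<Gamma> :: "'i set" and x :: "'i \<Rightarrow> 'a::banach"
  assumes M: "M_basis \<Gamma> x f"
    and C: "\<And>g :: 'a \<Rightarrow>\<^sub>L real. countable {\<gamma>\<in>\<Gamma>. blinfun_apply g (x \<gamma>) \<noteq> 0}"
  shows "weakly_Lindelof_determined TYPE('a)"
proof -
  have bi: "blinfun_apply (f \<alpha>) (x \<beta>) = (if \<alpha> = \<beta> then 1 else 0)"
    if "\<alpha> \<in> \<Gamma>" "\<beta> \<in> \<Gamma>" for \<alpha> \<beta>
    using M that by (simp add: M_basis_def biorthogonal_system_def)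
  have inj: "inj_on x \<Gamma>"
    by (rule inj_onI) (metis bi zero_neq_one)
  define f' where "f' = f \<circ> inv_into \<Gamma> x"
  have f': "f' (x \<gamma>) = f \<gamma>" if "\<gamma> \<in> \<Gamma>" for \<gamma>
    using inj that by (simp add: f'_def)
  have "f' ` (x ` \<Gamma>) = f ` \<Gamma>"
    unfolding image_image by (rule image_cong) (simp_all add: f')
  moreover have "biorthogonal_system (x ` \<Gamma>) id f'"
    using inj by (auto simp: biorthogonal_system_def f' bi inj_on_eq_iff)
  ultimately have "M_basis (x ` \<Gamma>) id f'"
    using M by (simp add: M_basis_def)
  moreover have "countable {y \<in> x ` \<Gamma>. blinfun_apply g (id y) \<noteq> 0}" for g :: "'a \<Rightarrow>\<^sub>L real"
  proof -
    have "{y \<in> x ` \<Gamma>. blinfun_apply g (id y) \<noteq> 0}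
        = x ` {\<gamma>\<in>\<Gamma>. blinfun_apply g (x \<gamma>) \<noteq> 0}"
      by auto
    then show ?thesis using C by simp
  qed
  ultimately show ?thesis
    unfolding weakly_Lindelof_determined_def by blast
qed

text \<open>The following two notions are meant for linear subspaces \<open>A\<close> and \<open>B\<close>, with the norms
  inherited from the ambient spaces. The map is only constrained on \<open>A\<close>: a bounded operator
  on a subspace need not extend to the ambient space.\<close>

definition linearly_isomorphic ::
    "'a::real_normed_vector set \<Rightarrow> 'b::real_normed_vector set \<Rightarrow> bool" where
  "linearly_isomorphic A B \<longleftrightarrow> (\<exists>T. bij_betw T A B
     \<and> (\<forall>x\<in>A. \<forall>y\<in>A. T (x + y) = T x + T y)
     \<and> (\<forall>c. \<forall>x\<in>A. T (c *\<^sub>R x) = c *\<^sub>R T x)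
     \<and> (\<exists>K. \<forall>x\<in>A. norm (T x) \<le> K * norm x)
     \<and> (\<exists>K. \<forall>y\<in>B. norm (inv_into A T y) \<le> K * norm y))"

definition densely_isomorphic ::
    "'a::real_normed_vector set \<Rightarrow> 'b::real_normed_vector set \<Rightarrow> bool" where
  "densely_isomorphic Y Z \<longleftrightarrow> (\<exists>Y0 Z0. subspace Y0 \<and> dense_in_topology (top_of_set Y) Y0
     \<and> subspace Z0 \<and> dense_in_topology (top_of_set Z) Z0
     \<and> linearly_isomorphic Y0 Z0)"

end

theory Submission
  imports Defs
begin

text \<open>Let \<open>Y\<close> be the linear span of the vectors \<open>x \<gamma>\<close> of the M-basis. Countably many continuous
  functionals on a subspace \<open>E\<close> of \<open>Y\<close> extend to the whole space by Hahn-Banach, so only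
  countably many indices matter for them; if they separate the points of \<open>E\<close>, then finitely
  supported coordinates on this countable index set determine the vectors of \<open>E\<close>, and \<open>E\<close> has
  countable algebraic dimension. Let \<open>Z\<close> be the span of small perturbations of the \<open>x \<gamma>\<close> by
  vectors whose coordinates along a fixed sequence in \<open>\<Gamma>\<close> are weighted powers of distinct positive
  reals, of which there are enough because \<open>\<Gamma>\<close> has at most the cardinality of the continuum. By a
  Vandermonde argument, countably many coordinate functionals separate the points of \<open>Z\<close>. This
  property passes to subspaces and along isomorphisms, so a subspace of \<open>Y\<close> isomorphic to a
  subspace of \<open>Z\<close> is separable.\<close>

section \<open>Hahn-Banach extension from arbitrary linear subspaces\<close>

text \<open>One-dimensional step of Hahn-Banach. A partial functional is encoded as its graph, a
  subspace of the product; domination by \<open>K * norm x\<close> then also gives the bound for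
  \<open>- t\<close>, and forces the value 0 at 0. No case split on whether \<open>x0\<close>
  already lies in the domain is needed, since the bounds on \<alpha> then force the old
  value.\<close>

lemma dominated_graph_extend:
  fixes M :: "('a::real_normed_vector \<times> real) set"
  assumes M: "subspace M" and dom: "\<And>x t. (x, t) \<in> M \<Longrightarrow> t \<le> K * norm x" and K: "K \<ge> 0"
  obtains M' where "subspace M'" "M \<subseteq> M'" "x0 \<in> fst ` M'"
    "\<And>x t. (x, t) \<in> M' \<Longrightarrow> t \<le> K * norm x"
proof -
  \<comment> \<open>Every lower candidate for the value at \<open>x0\<close> lies below every upper
    one, by the triangle inequality for \<open>y + z = (y - x0) + (z + x0)\<close>; the supremum of
    the lower ones is therefore admissible.\<close>
  have key: "s - K * norm (y - x0) \<le> K * norm (z + x0) - t"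
    if "(y, s) \<in> M" "(z, t) \<in> M" for y z s t
  proof -
    have "(y + z, s + t) \<in> M"
      using subspace_add[OF M that(1,2)] by simp
    then have "s + t \<le> K * norm (y + z)" by (rule dom)
    also have "\<dots> \<le> K * (norm (y - x0) + norm (z + x0))"
      using norm_triangle_ineq[of "y - x0" "z + x0"] K
      by (intro mult_left_mono) (auto simp: algebra_simps)
    finally show ?thesis by (simp add: algebra_simps)
  qed
  have 0: "(0, 0) \<in> M" using subspace_0[OF M] by (simp add: zero_prod_def)
  define \<alpha> where "\<alpha> = (SUP (y, s)\<in>M. s - K * norm (y - x0))"
  have bdd: "bdd_above ((\<lambda>(y, s). s - K * norm (y - x0)) ` M)"
    using key[OF _ 0] by (intro bdd_aboveI2[where M = "K * norm (0 + x0) - 0"]) auto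
  have lower: "s - K * norm (y - x0) \<le> \<alpha>" if "(y, s) \<in> M" for y s
    unfolding \<alpha>_def using cSUP_upper[OF that bdd] by simp
  have upper: "\<alpha> \<le> K * norm (z + x0) - t" if "(z, t) \<in> M" for z t
    unfolding \<alpha>_def using 0 key[OF _ that] by (intro cSUP_least) auto
  define M' where "M' = span (insert (x0, \<alpha>) M)"
  have "t \<le> K * norm x" if xt: "(x, t) \<in> M'" for x t
  proof -
    have "\<exists>c. (x, t) - c *\<^sub>R (x0, \<alpha>) \<in> span M"
      using xt unfolding M'_def span_insert mem_Collect_eq .
    then obtain c where "(x, t) - c *\<^sub>R (x0, \<alpha>) \<in> span M" ..
    then have m: "(x - c *\<^sub>R x0, t - c * \<alpha>) \<in> M"
      using M by (simp add: span_eq_iff[THEN iffD2])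
    have inv: "inverse c * (c * \<alpha>) = \<alpha>" if "c \<noteq> 0"
      using that by (simp add: field_simps)
    \<comment> \<open>Dividing by the modulus of \<open>c\<close> turns the case of positive
      \<open>c\<close> into \<open>upper\<close> and that of negative \<open>c\<close> into
      \<open>lower\<close>.\<close>
    consider "c = 0" | "c > 0" | "c < 0" by linarith
    then show ?thesis
    proof cases
      case 1
      with m have "(x, t) \<in> M" by simp
      then show ?thesis by (rule dom)
    next
      case 2
      have "(x /\<^sub>R c - x0, t / c - \<alpha>) \<in> M"
        using subspace_scale[OF M m, of "inverse c"] 2
        by (simp add: scaleR_diff_right right_diff_distrib divide_inverse_commute inv)
      from upper[OF this] have "t / c \<le> K * norm (x /\<^sub>R c)" by simp
      also have "\<dots> = K * norm x / c" using 2 by (simp add: divide_inverse_commute)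
      finally show ?thesis using 2 by (simp add: divide_le_cancel)
    next
      case 3
      have "(x0 - x /\<^sub>R c, \<alpha> - t / c) \<in> M"
        using subspace_scale[OF M m, of "- inverse c"] 3
        by (simp add: scaleR_diff_right right_diff_distrib divide_inverse_commute inv)
      from lower[OF this] have "- (t / c) \<le> K * norm (x /\<^sub>R c)" by simp
      also have "\<dots> = - (K * norm x / c)" using 3 by (simp add: divide_inverse_commute)
      finally have "K * norm x / c \<le> t / c" by simp
      then show ?thesis using 3 by (simp add: divide_le_cancel)
    qed
  qed
  moreover have "(x0, \<alpha>) \<in> M'" unfolding M'_def by (rule span_base) simp
  then have "x0 \<in> fst ` M'" by force
  moreover have "M \<subseteq> M'" unfolding M'_def by (meson span_superset subset_insertI subset_trans)
  moreover have "subspace M'" unfolding M'_def by (rule subspace_span)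
  ultimately show thesis by (intro that[of M'])
qed

text \<open>Zorn's lemma: unions of nonempty chains of dominated graphs are again dominated graphs,
  and a maximal one has full domain because it could otherwise be extended by one more
  point.\<close>

lemma dominated_graph_maximal:
  fixes G :: "('a::real_normed_vector \<times> real) set"
  assumes G: "subspace G" and dom: "\<And>x t. (x, t) \<in> G \<Longrightarrow> t \<le> K * norm x" and K: "K \<ge> 0"
  obtains M where "subspace M" "G \<subseteq> M" "fst ` M = UNIV"
    "\<And>x t. (x, t) \<in> M \<Longrightarrow> t \<le> K * norm x"
proof -
  define \<A> where "\<A> = {M. subspace M \<and> G \<subseteq> M \<and> (\<forall>x t. (x, t) \<in> M \<longrightarrow> t \<le> K * norm x)}"
  have "G \<in> \<A>" using G dom by (auto simp: \<A>_def)
  have "\<exists>M\<in>\<A>. \<forall>X\<in>\<A>. M \<subseteq> X \<longrightarrow> X = M"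
  proof (rule subset_Zorn_nonempty)
    show "\<A> \<noteq> {}" using \<open>G \<in> \<A>\<close> by blast
  next
    fix \<C> assume \<C>: "\<C> \<noteq> {}" "subset.chain \<A> \<C>"
    then have sub: "\<C> \<subseteq> \<A>" and tot: "\<And>X Y. X \<in> \<C> \<Longrightarrow> Y \<in> \<C> \<Longrightarrow> X \<subseteq> Y \<or> Y \<subseteq> X"
      by (auto simp: subset_chain_def)
    have "subspace (\<Union>\<C>)"
    proof (rule subspaceI)
      show "0 \<in> \<Union>\<C>"
      proof -
        obtain X where "X \<in> \<C>" using \<C>(1) by blast
        moreover have "subspace X" using \<open>X \<in> \<C>\<close> sub by (auto simp: \<A>_def)
        ultimately show ?thesis using subspace_0 by blast
      qed
    next
      fix p q assume "p \<in> \<Union>\<C>" "q \<in> \<Union>\<C>"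
      then obtain X where "X \<in> \<C>" "p \<in> X" "q \<in> X" using tot by blast
      moreover have "subspace X" using \<open>X \<in> \<C>\<close> sub by (auto simp: \<A>_def)
      ultimately show "p + q \<in> \<Union>\<C>" by (blast intro: subspace_add)
    next
      fix p and c :: real assume "p \<in> \<Union>\<C>"
      then obtain X where "X \<in> \<C>" "p \<in> X" by blast
      moreover have "subspace X" using \<open>X \<in> \<C>\<close> sub by (auto simp: \<A>_def)
      ultimately show "c *\<^sub>R p \<in> \<Union>\<C>" by (blast intro: subspace_scale)
    qed
    moreover have "G \<subseteq> \<Union>\<C>" using \<C>(1) sub by (auto simp: \<A>_def)
    moreover have "t \<le> K * norm x" if "(x, t) \<in> \<Union>\<C>" for x t
      using that sub by (auto simp: \<A>_def)
    ultimately show "\<Union>\<C> \<in> \<A>" by (simp add: \<A>_def)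
  qed
  then obtain M where M: "M \<in> \<A>" and max: "\<And>X. X \<in> \<A> \<Longrightarrow> M \<subseteq> X \<Longrightarrow> X = M" by blast
  have "x0 \<in> fst ` M" for x0
  proof -
    obtain M' where "subspace M'" "M \<subseteq> M'" "x0 \<in> fst ` M'"
      "\<And>x t. (x, t) \<in> M' \<Longrightarrow> t \<le> K * norm x"
      using dominated_graph_extend[of M K x0] M K unfolding \<A>_def by blast
    moreover then have "M' = M" using M by (intro max) (auto simp: \<A>_def)
    ultimately show ?thesis by simp
  qed
  then have "fst ` M = UNIV" by blast
  with M that[of M] show thesis by (auto simp: \<A>_def)
qed

text \<open>Linearity and boundedness are asked for on \<open>E\<close> only, because the
  functionals to be extended arise by composition with an isomorphism that is constrained only on a
  subspace.\<close>

theorem Hahn_Banach_extension: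
  fixes E :: "'a::real_normed_vector set" and \<phi> :: "'a \<Rightarrow> real"
  assumes E: "subspace E"
    and add: "\<And>x y. x \<in> E \<Longrightarrow> y \<in> E \<Longrightarrow> \<phi> (x + y) = \<phi> x + \<phi> y"
    and scale: "\<And>c x. x \<in> E \<Longrightarrow> \<phi> (c *\<^sub>R x) = c * \<phi> x"
    and bound: "\<And>x. x \<in> E \<Longrightarrow> \<bar>\<phi> x\<bar> \<le> K * norm x"
  obtains g :: "'a \<Rightarrow>\<^sub>L real" where "\<And>x. x \<in> E \<Longrightarrow> blinfun_apply g x = \<phi> x"
proof -
  let ?G = "(\<lambda>x. (x, \<phi> x)) ` E"
  have "subspace ?G"
  proof (rule subspaceI)
    have "\<phi> 0 = 0" using scale[of 0 0] subspace_0[OF E] by simp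
    then show "0 \<in> ?G" using subspace_0[OF E] by (force simp: zero_prod_def)
  next
    fix p q assume "p \<in> ?G" "q \<in> ?G"
    then show "p + q \<in> ?G" using add subspace_add[OF E] by (auto simp: image_iff)
  next
    fix c and p assume "p \<in> ?G"
    then show "c *\<^sub>R p \<in> ?G" using scale subspace_scale[OF E] by (auto simp: image_iff)
  qed
  moreover have "t \<le> max K 0 * norm x" if "(x, t) \<in> ?G" for x t
  proof -
    have "x \<in> E" "t = \<phi> x" using that by auto
    then have "t \<le> K * norm x" using bound[of x] by simp
    also have "\<dots> \<le> max K 0 * norm x" by (intro mult_right_mono) auto
    finally show ?thesis .
  qed
  ultimately obtain M where M: "subspace M" "?G \<subseteq> M" "fst ` M = UNIV"
    and dom: "\<And>x t. (x, t) \<in> M \<Longrightarrow> t \<le> max K 0 * norm x"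
    by (rule dominated_graph_maximal[of ?G "max K 0"]) auto
  \<comment> \<open>Two values at one point differ by a value at 0, where domination allows only 0.
    So \<open>M\<close> is the graph of a function.\<close>
  have uniq: "s = t" if "(x, s) \<in> M" "(x, t) \<in> M" for x s t
    using dom[of 0 "s - t"] dom[of 0 "t - s"] subspace_diff[OF M(1) that]
      subspace_diff[OF M(1) that(2,1)] by simp
  obtain h where h: "\<And>x. (x, h x) \<in> M"
  proof -
    have "\<forall>x. \<exists>t. (x, t) \<in> M" using M(3) by (metis UNIV_I imageE prod.collapse)
    then show thesis using that by metis
  qed
  have "bounded_linear h"
  proof (rule bounded_linear_intro[where K = "max K 0"])
    fix x y show "h (x + y) = h x + h y"
      using uniq[OF h] subspace_add[OF M(1) h h, of x y] by simp
  next
    fix c x show "h (c *\<^sub>R x) = c *\<^sub>R h x"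
      using uniq[OF h] subspace_scale[OF M(1) h, of c x] by simp
  next
    fix x show "norm (h x) \<le> norm x * max K 0"
      using dom[OF h, of x] dom[of "- x" "- h x"] subspace_neg[OF M(1) h, of x]
      by (simp add: mult.commute abs_le_iff)
  qed
  moreover have "h x = \<phi> x" if "x \<in> E" for x
    using uniq[OF h] M(2) that by blast
  ultimately show thesis using that[of "Blinfun h"] by (simp add: bounded_linear_Blinfun_apply)
qed

section \<open>Separability of subspaces and spans\<close>

lemma separable_space_top_of_set_iff:
  "separable_space (top_of_set S) \<longleftrightarrow> (\<exists>C. countable C \<and> C \<subseteq> S \<and> S \<subseteq> closure C)"
proof -
  have "top_of_set S closure_of C = S \<longleftrightarrow> S \<subseteq> closure C" if "C \<subseteq> S" for C
    using that by (auto simp: closure_of_subtopology Int_absorb1)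
  then show ?thesis unfolding separable_space_def by auto
qed

lemma separable_space_top_of_set_mono_dense:
  assumes "separable_space (top_of_set S)" "S \<subseteq> T" "T \<subseteq> closure S"
  shows "separable_space (top_of_set T)"
proof -
  obtain C where "countable C" "C \<subseteq> S" "S \<subseteq> closure C"
    using assms(1) by (auto simp: separable_space_top_of_set_iff)
  then show ?thesis
    using assms(2,3) closure_minimal[of S "closure C"]
    unfolding separable_space_top_of_set_iff by (meson closed_closure dual_order.trans)
qed

lemma subspace_closure:
  fixes S :: "'a::real_normed_vector set"
  assumes S: "subspace S"
  shows "subspace (closure S)"
proof (rule subspaceI)
  show "0 \<in> closure S" using subspace_0[OF S] closure_subset by blast
next
  fix y z assume "y \<in> closure S" "z \<in> closure S"
  then obtain u v where "\<And>n. u n \<in> S" "u \<longlonglongrightarrow> y" "\<And>n. v n \<in> S" "v \<longlonglongrightarrow> z"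
    unfolding closure_sequential by blast
  then show "y + z \<in> closure S"
    unfolding closure_sequential
    by (intro exI[of _ "\<lambda>n. u n + v n"] conjI allI tendsto_add subspace_add[OF S])
next
  fix c :: real and y assume "y \<in> closure S"
  then obtain u where "\<And>n. u n \<in> S" "u \<longlonglongrightarrow> y"
    unfolding closure_sequential by blast
  then show "c *\<^sub>R y \<in> closure S"
    unfolding closure_sequential
    by (intro exI[of _ "\<lambda>n. c *\<^sub>R u n"] conjI allI tendsto_scaleR tendsto_const
        subspace_scale[OF S])
qed

text \<open>The rational combinations of \<open>B\<close> form a countable set whose closure is a
  real subspace containing \<open>B\<close>.\<close>

lemma separable_space_span_countable:
  fixes B :: "'a::real_normed_vector set"
  assumes "countable B"
  shows "separable_space (top_of_set (span B))"
proof -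
  \<comment> \<open>Lists may repeat vectors, so sums are concatenations and no coefficients have to
    be collected.\<close>
  define C where "C = (\<lambda>l. \<Sum>(q, b)\<leftarrow>l. of_rat q *\<^sub>R b) ` lists ((UNIV :: rat set) \<times> B)"
  have "countable C" unfolding C_def using assms by auto
  moreover have "C \<subseteq> span B"
  proof -
    have "(\<Sum>(q, b)\<leftarrow>l. of_rat q *\<^sub>R b) \<in> span B" if "set l \<subseteq> (UNIV :: rat set) \<times> B" for l
      using that by (induction l) (auto intro!: span_add span_scale intro: span_base span_zero)
    then show ?thesis by (auto simp: C_def lists_eq_set)
  qed
  moreover have "span B \<subseteq> closure C"
  proof (rule span_minimal)
    have C_scale: "of_rat q *\<^sub>R y \<in> C" if "y \<in> C" for q y
    proof -
      obtain l where l: "set l \<subseteq> UNIV \<times> B" "y = (\<Sum>(q, b)\<leftarrow>l. of_rat q *\<^sub>R b)"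
        using \<open>y \<in> C\<close> by (auto simp: C_def lists_eq_set)
      have "of_rat q *\<^sub>R (\<Sum>(q, b)\<leftarrow>l. of_rat q *\<^sub>R b)
          = (\<Sum>(q, b)\<leftarrow>map (apfst ((*) q)) l. of_rat q *\<^sub>R b)"
        by (induction l) (auto simp: of_rat_mult scaleR_add_right)
      moreover have "set (map (apfst ((*) q)) l) \<subseteq> UNIV \<times> B"
        using l(1) by auto
      ultimately show ?thesis unfolding C_def lists_eq_set l(2) by blast
    qed
    have C_add: "y + z \<in> C" if "y \<in> C" "z \<in> C" for y z
    proof -
      obtain l where l: "set l \<subseteq> UNIV \<times> B" "y = (\<Sum>(q, b)\<leftarrow>l. of_rat q *\<^sub>R b)"
        using \<open>y \<in> C\<close> by (auto simp: C_def lists_eq_set)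
      obtain m where m: "set m \<subseteq> UNIV \<times> B" "z = (\<Sum>(q, b)\<leftarrow>m. of_rat q *\<^sub>R b)"
        using \<open>z \<in> C\<close> by (auto simp: C_def lists_eq_set)
      have "y + z = (\<Sum>(q, b)\<leftarrow>l @ m. of_rat q *\<^sub>R b)" "set (l @ m) \<subseteq> UNIV \<times> B"
        using l m by auto
      then show ?thesis unfolding C_def lists_eq_set by blast
    qed
    have "b \<in> C" if "b \<in> B" for b
      unfolding C_def lists_eq_set using that by (intro image_eqI[of _ _ "[(1, b)]"]) auto
    then show "B \<subseteq> closure C" using closure_subset by blast
    show "subspace (closure C)"
    proof (rule subspaceI)
      have "0 \<in> C" unfolding C_def by (intro image_eqI[of _ _ "[]"]) auto
      then show "0 \<in> closure C" using closure_subset by blast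
    next
      fix y z assume "y \<in> closure C" "z \<in> closure C"
      then obtain u v where "\<And>n. u n \<in> C" "u \<longlonglongrightarrow> y" "\<And>n. v n \<in> C" "v \<longlonglongrightarrow> z"
        unfolding closure_sequential by blast
      then show "y + z \<in> closure C"
        unfolding closure_sequential
        by (intro exI[of _ "\<lambda>n. u n + v n"] conjI allI tendsto_add C_add)
    next
      fix c :: real and y assume "y \<in> closure C"
      then obtain u where u: "\<And>n. u n \<in> C" "u \<longlonglongrightarrow> y"
        unfolding closure_sequential by blast
      \<comment> \<open>The real scalar is approximated by rationals along with the approximation
        \<open>u\<close> of the vector, so that the products stay in \<open>C\<close>.\<close>
      have "c \<in> closure (range of_rat)"
        using Rats_closure_real by (simp add: Rats_def)
      then obtain r where r: "\<And>n. r n \<in> range of_rat" "r \<longlonglongrightarrow> c"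
        unfolding closure_sequential by blast
      have "\<forall>n. \<exists>q. r n = of_rat q" using r(1) by blast
      then obtain q where "\<And>n. r n = of_rat (q n)" by metis
      then have "r = (\<lambda>n. of_rat (q n))" by auto
      with r(2) have q: "(\<lambda>n. of_rat (q n)) \<longlonglongrightarrow> c" by simp
      have "(\<lambda>n. of_rat (q n) *\<^sub>R u n) \<longlonglongrightarrow> c *\<^sub>R y" using q u by (intro tendsto_scaleR)
      then show "c *\<^sub>R y \<in> closure C"
        unfolding closure_sequential using C_scale u(1)
        by (intro exI[of _ "\<lambda>n. of_rat (q n) *\<^sub>R u n"]) auto
    qed
  qed
  ultimately show ?thesis unfolding separable_space_top_of_set_iff by blast
qed

section \<open>Linear isomorphisms between subspaces\<close>

text \<open>Sums and multiples of preimages stay in the subspace \<open>A\<close>, where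
  \<open>T\<close> is linear; applying the inverse there shows that the inverse is linear.\<close>

lemma linearly_isomorphic_sym:
  assumes "subspace A" "linearly_isomorphic A B"
  shows "linearly_isomorphic B A"
proof -
  obtain T K L where T: "bij_betw T A B"
    and add: "\<And>x y. x \<in> A \<Longrightarrow> y \<in> A \<Longrightarrow> T (x + y) = T x + T y"
    and scale: "\<And>c x. x \<in> A \<Longrightarrow> T (c *\<^sub>R x) = c *\<^sub>R T x"
    and K: "\<And>x. x \<in> A \<Longrightarrow> norm (T x) \<le> K * norm x"
    and L: "\<And>y. y \<in> B \<Longrightarrow> norm (inv_into A T y) \<le> L * norm y"
    using assms(2) unfolding linearly_isomorphic_def by metis
  define S where "S = inv_into A T"
  have S: "bij_betw S B A" unfolding S_def using T by (rule bij_betw_inv_into)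
  have TS: "T (S y) = y" if "y \<in> B" for y
    unfolding S_def using T that by (rule bij_betw_inv_into_right)
  have ST: "S (T x) = x" if "x \<in> A" for x
    unfolding S_def using T that by (rule bij_betw_inv_into_left)
  have SB: "S y \<in> A" if "y \<in> B" for y using S that by (rule bij_betwE[THEN bspec])
  have "S (y + z) = S y + S z" if "y \<in> B" "z \<in> B" for y z
    using add[OF SB SB, OF that] ST[OF subspace_add[OF assms(1) SB SB, OF that]] TS that by simp
  moreover have "S (c *\<^sub>R y) = c *\<^sub>R S y" if "y \<in> B" for c y
    using scale[OF SB, OF that] ST[OF subspace_scale[OF assms(1) SB, OF that]] TS that by simp
  moreover have "norm (inv_into B S x) \<le> K * norm x" if "x \<in> A" for x
  proof -
    have "inv_into B S x = T x"
      using S T that by (metis ST bij_betw_inv_into_left bij_betwE)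
    with K that show ?thesis by simp
  qed
  ultimately show ?thesis
    unfolding linearly_isomorphic_def using S L[folded S_def]
    by (intro exI[of _ S] conjI exI[of _ L] exI[of _ K]) auto
qed

text \<open>A bounded linear map is Lipschitz, and continuous images of separable spaces are
  separable.\<close>

lemma separable_space_linearly_isomorphic:
  assumes "subspace A" "linearly_isomorphic A B" "separable_space (top_of_set A)"
  shows "separable_space (top_of_set B)"
proof -
  obtain T K where T: "bij_betw T A B"
    and add: "\<And>x y. x \<in> A \<Longrightarrow> y \<in> A \<Longrightarrow> T (x + y) = T x + T y"
    and scale: "\<And>c x. x \<in> A \<Longrightarrow> T (c *\<^sub>R x) = c *\<^sub>R T x"
    and K: "\<And>x. x \<in> A \<Longrightarrow> norm (T x) \<le> K * norm x"
    using assms(2) unfolding linearly_isomorphic_def by metis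
  have diff: "T (x - y) = T x - T y" if "x \<in> A" "y \<in> A" for x y
    using add[of "x - y" y] that subspace_diff[OF assms(1) that] by simp
  have "(max K 0)-lipschitz_on A T"
  proof (rule lipschitz_onI)
    fix x y assume xy: "x \<in> A" "y \<in> A"
    have "norm (T x - T y) \<le> K * norm (x - y)"
      using K[OF subspace_diff[OF assms(1) xy]] diff[OF xy] by simp
    also have "\<dots> \<le> max K 0 * norm (x - y)" by (intro mult_right_mono) auto
    finally show "dist (T x) (T y) \<le> max K 0 * dist x y" by (simp add: dist_norm)
  qed simp
  then have "continuous_on A T" by (rule lipschitz_on_continuous_on)
  then show ?thesis
    using assms(3) T separable_space_continuous_map_image[of "top_of_set A" "top_of_set B" T]
    by (auto simp: bij_betw_def)
qed

section \<open>Vandermonde elimination and explicit finite combinations\<close>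

text \<open>Subtracting \<open>\<mu> j\<close> times the equation for \<open>n\<close> from the one
  for \<open>Suc n\<close> removes the index \<open>j\<close> and multiplies each other coefficient
  by the nonzero factor \<open>\<mu> i - \<mu> j\<close>. The equations start at \<open>N\<close>
  because in the application finitely many coordinates are disturbed.\<close>

lemma vandermonde_injective:
  fixes c \<mu> :: "'i \<Rightarrow> 'b::field"
  assumes "finite I" "inj_on \<mu> I" "\<And>i. i \<in> I \<Longrightarrow> \<mu> i \<noteq> 0"
    and "\<And>n. n \<ge> N \<Longrightarrow> (\<Sum>i\<in>I. c i * \<mu> i ^ n) = 0" and "i \<in> I"
  shows "c i = 0"
  using assms
proof (induction I arbitrary: c i rule: finite_induct)
  case (insert j I)
  have "c k = 0" if "k \<in> I" for k
  proof -
    have "(\<Sum>i\<in>I. c i * (\<mu> i - \<mu> j) * \<mu> i ^ n) = 0" if "n \<ge> N" for n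
    proof -
      have "(\<Sum>i\<in>I. c i * (\<mu> i - \<mu> j) * \<mu> i ^ n)
          = (\<Sum>i\<in>insert j I. c i * \<mu> i ^ Suc n) - \<mu> j * (\<Sum>i\<in>insert j I. c i * \<mu> i ^ n)"
        using insert.hyps
        by (simp add: sum_subtractf[symmetric] sum_distrib_left algebra_simps)
      also have "\<dots> = 0" using insert.prems(3)[of n] insert.prems(3)[of "Suc n"] that by simp
      finally show ?thesis .
    qed
    then have "c k * (\<mu> k - \<mu> j) = 0"
      using insert.IH[of "\<lambda>i. c i * (\<mu> i - \<mu> j)" k] insert.prems(1,2) that by simp
    moreover have "\<mu> k \<noteq> \<mu> j" using insert.prems(1) insert.hyps that by (auto simp: inj_on_def)
    ultimately show ?thesis by simp
  qed
  \<comment> \<open>Only \<open>c j * \<mu> j ^ N = 0\<close> is left, and \<open>\<mu> j\<close> is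
    nonzero.\<close>
  moreover from this have "c j = 0"
    using insert.prems(3)[of N] insert.hyps insert.prems(2)[of j] by simp
  ultimately show ?case using insert.prems(4) by blast
qed simp

text \<open>The sum runs over indices, as the Vandermonde argument compares parameters attached to
  indices. Choosing one index per vector makes this possible without knowing that \<open>z\<close>
  is injective.\<close>

lemma span_image_explicit:
  assumes "v \<in> span (z ` P)"
  obtains I c where "finite I" "I \<subseteq> P" "v = (\<Sum>p\<in>I. c p *\<^sub>R z p)"
proof -
  obtain t r where t: "finite t" "t \<subseteq> z ` P" "v = (\<Sum>a\<in>t. r a *\<^sub>R a)"
    using assms unfolding span_explicit by blast
  obtain I where I: "I \<subseteq> P" "inj_on z I" "t = z ` I"
    using t(2) unfolding subset_image_inj by blast
  have "v = (\<Sum>p\<in>I. r (z p) *\<^sub>R z p)"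
    using t(3) I(2,3) by (simp add: sum.reindex)
  moreover have "finite I" using t(1) I(2,3) by (simp add: finite_image_iff)
  ultimately show thesis using that[of I "\<lambda>p. r (z p)"] I(1) by simp
qed

section \<open>Separability of subspaces of the span of the basis vectors\<close>

locale weakly_Lindelof_system =
  fixes \<Gamma> :: "'i set" and x :: "'i \<Rightarrow> 'a::banach" and f :: "'i \<Rightarrow> 'a \<Rightarrow>\<^sub>L real"
  assumes biorthogonal: "biorthogonal_system \<Gamma> x f"
    and fundamental: "closure (span (x ` \<Gamma>)) = UNIV"
    and countable_functional_support:
      "\<And>g :: 'a \<Rightarrow>\<^sub>L real. countable {\<gamma>\<in>\<Gamma>. blinfun_apply g (x \<gamma>) \<noteq> 0}"
begin

lemma f_x: "\<alpha> \<in> \<Gamma> \<Longrightarrow> \<beta> \<in> \<Gamma> \<Longrightarrow> f \<alpha> (x \<beta>) = (if \<alpha> = \<beta> then 1 else 0)"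
  using biorthogonal by (simp add: biorthogonal_system_def)

lemma x_nonzero: "\<gamma> \<in> \<Gamma> \<Longrightarrow> x \<gamma> \<noteq> 0"
  using f_x[of \<gamma> \<gamma>] by auto

text \<open>By biorthogonality the coefficients of a finite combination of the
  \<open>x \<gamma>\<close> are its coordinates.\<close>

lemma finite_coordinate_expansion:
  assumes "v \<in> span (x ` \<Gamma>)"
  shows "finite {\<gamma>\<in>\<Gamma>. f \<gamma> v \<noteq> 0} \<and> v = (\<Sum>\<gamma> | \<gamma> \<in> \<Gamma> \<and> f \<gamma> v \<noteq> 0. f \<gamma> v *\<^sub>R x \<gamma>)"
proof -
  \<comment> \<open>The induction carries a finite superset \<open>F\<close> of the support, since
    adding a term may cancel a coordinate.\<close>
  have "\<exists>F\<subseteq>\<Gamma>. finite F \<and> (\<forall>\<gamma>\<in>\<Gamma> - F. f \<gamma> v = 0) \<and> v = (\<Sum>\<gamma>\<in>F. f \<gamma> v *\<^sub>R x \<gamma>)"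
    using assms
  proof (induction rule: span_induct_alt)
    case base
    show ?case by (intro exI[of _ "{}"]) simp
  next
    case (step c y v)
    then obtain \<beta> where \<beta>: "\<beta> \<in> \<Gamma>" "y = x \<beta>" by blast
    obtain F where F: "F \<subseteq> \<Gamma>" "finite F" "\<And>\<gamma>. \<gamma> \<in> \<Gamma> - F \<Longrightarrow> f \<gamma> v = 0"
      "v = (\<Sum>\<gamma>\<in>F. f \<gamma> v *\<^sub>R x \<gamma>)"
      using step.IH by blast
    have coord: "f \<gamma> (c *\<^sub>R y + v) = (if \<gamma> = \<beta> then c else 0) + f \<gamma> v" if "\<gamma> \<in> \<Gamma>" for \<gamma>
      using f_x[OF that \<beta>(1)] by (simp add: \<beta>(2) blinfun.add_right blinfun.scaleR_right)
    have "(\<Sum>\<gamma>\<in>insert \<beta> F. f \<gamma> (c *\<^sub>R y + v) *\<^sub>R x \<gamma>)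
        = (\<Sum>\<gamma>\<in>insert \<beta> F. (if \<gamma> = \<beta> then c *\<^sub>R x \<gamma> else 0) + f \<gamma> v *\<^sub>R x \<gamma>)"
      using F(1) \<beta>(1) by (intro sum.cong) (auto simp: coord scaleR_add_left)
    also have "\<dots> = c *\<^sub>R y + (\<Sum>\<gamma>\<in>insert \<beta> F. f \<gamma> v *\<^sub>R x \<gamma>)"
      using F(2) by (simp add: sum.distrib \<beta>(2) sum.delta del: sum.insert)
    also have "(\<Sum>\<gamma>\<in>insert \<beta> F. f \<gamma> v *\<^sub>R x \<gamma>) = (\<Sum>\<gamma>\<in>F. f \<gamma> v *\<^sub>R x \<gamma>)"
      using F(2,3) \<beta>(1) by (intro sum.mono_neutral_right) auto
    finally have "(\<Sum>\<gamma>\<in>insert \<beta> F. f \<gamma> (c *\<^sub>R y + v) *\<^sub>R x \<gamma>) = c *\<^sub>R y + v" using F(4) by simp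
    then show ?case
      using F \<beta>(1) by (intro exI[of _ "insert \<beta> F"]) (auto simp: coord)
  qed
  then obtain F where F: "F \<subseteq> \<Gamma>" "finite F" "\<And>\<gamma>. \<gamma> \<in> \<Gamma> - F \<Longrightarrow> f \<gamma> v = 0"
    "v = (\<Sum>\<gamma>\<in>F. f \<gamma> v *\<^sub>R x \<gamma>)"
    by blast
  have sub: "{\<gamma>\<in>\<Gamma>. f \<gamma> v \<noteq> 0} \<subseteq> F" using F(3) by blast
  have "(\<Sum>\<gamma> | \<gamma> \<in> \<Gamma> \<and> f \<gamma> v \<noteq> 0. f \<gamma> v *\<^sub>R x \<gamma>) = (\<Sum>\<gamma>\<in>F. f \<gamma> v *\<^sub>R x \<gamma>)"
    using sub F(1,2) by (intro sum.mono_neutral_left) auto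
  then show ?thesis using finite_subset[OF sub F(2)] F(4) by simp
qed

text \<open>Each vector of a Hamel basis \<open>B\<close> of \<open>E\<close> has finitely many
  nonzero coordinates in \<open>N\<close>. For each finite \<open>F\<close>, those whose coordinates
  in \<open>N\<close> are supported in \<open>F\<close> lie in a space that embeds into the span of
  \<open>x\<close> over \<open>F\<close>, so they are finitely many. As \<open>N\<close> has
  countably many finite subsets, \<open>B\<close> is countable.\<close>

lemma separable_if_determined_by_countable_coordinates:
  assumes E: "subspace E" "E \<subseteq> span (x ` \<Gamma>)" and N: "countable N" "N \<subseteq> \<Gamma>"
    and inj: "\<And>e. e \<in> E \<Longrightarrow> (\<And>\<gamma>. \<gamma> \<in> N \<Longrightarrow> f \<gamma> e = 0) \<Longrightarrow> e = 0"
  shows "separable_space (top_of_set E)"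
proof -
  obtain B where B: "B \<subseteq> E" "independent B" "E \<subseteq> span B"
    using maximal_independent_subset by blast
  have "span B = E" using span_minimal[OF B(1) E(1)] B(3) by blast
  define E' where "E' F = {e\<in>E. \<forall>\<gamma>\<in>N - F. f \<gamma> e = 0}" for F
  have fin: "finite (B \<inter> E' F)" if F: "finite F" "F \<subseteq> N" for F
  proof -
    \<comment> \<open>\<open>S\<close> keeps the coordinates in \<open>F\<close>. On
      \<open>E' F\<close> the remaining coordinates in \<open>N\<close> vanish, so
      \<open>inj\<close> makes \<open>S\<close> injective there.\<close>
    define S where "S e = (\<Sum>\<gamma>\<in>F. f \<gamma> e *\<^sub>R x \<gamma>)" for e
    have "linear S"
      by (intro linearI) (auto simp: S_def blinfun.add_right blinfun.scaleR_right
          scaleR_add_left sum.distrib scaleR_sum_right)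
    have fS: "f \<gamma> (S e) = f \<gamma> e" if "\<gamma> \<in> F" for \<gamma> e
    proof -
      have "f \<gamma> (S e) = (\<Sum>\<beta>\<in>F. f \<beta> e * f \<gamma> (x \<beta>))"
        by (simp add: S_def blinfun.sum_right blinfun.scaleR_right)
      also have "\<dots> = (\<Sum>\<beta>\<in>F. if \<gamma> = \<beta> then f \<beta> e else 0)"
        using F N that by (intro sum.cong refl) (subst f_x, auto)
      finally show ?thesis using that F(1) by simp
    qed
    have E'F: "subspace (E' F)"
      using subspace_0[OF E(1)] subspace_add[OF E(1)] subspace_scale[OF E(1)]
      by (auto simp: E'_def subspace_def blinfun.add_right blinfun.scaleR_right blinfun.zero_right)
    have "inj_on S (E' F)"
    proof (rule inj_onI)
      fix a b assume ab: "a \<in> E' F" "b \<in> E' F" "S a = S b"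
      have d: "a - b \<in> E' F" using subspace_diff[OF E'F ab(1,2)] .
      have "f \<gamma> (a - b) = 0" if "\<gamma> \<in> N" for \<gamma>
      proof (cases "\<gamma> \<in> F")
        case True
        then show ?thesis using fS[OF True, of a] fS[OF True, of b] ab(3)
          by (simp add: blinfun.diff_right)
      next
        case False
        then show ?thesis using d that by (auto simp: E'_def)
      qed
      then show "a = b" using inj[of "a - b"] d by (simp add: E'_def)
    qed
    moreover have "span (B \<inter> E' F) \<subseteq> E' F" by (intro span_minimal E'F) auto
    ultimately have injS: "inj_on S (span (B \<inter> E' F))" by (rule inj_on_subset)
    have "independent (B \<inter> E' F)" using B(2) by (rule independent_mono) simp
    then have "independent (S ` (B \<inter> E' F))"
      using \<open>linear S\<close> injS by (intro linear_independent_injective_image)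
    moreover have "S ` (B \<inter> E' F) \<subseteq> span (x ` F)"
      unfolding S_def by (intro image_subsetI span_sum span_scale span_base imageI)
    ultimately have "finite (S ` (B \<inter> E' F))"
      using independent_span_bound[of "x ` F"] F(1) by blast
    moreover have "inj_on S (B \<inter> E' F)" using injS by (rule inj_on_subset) (rule span_superset)
    ultimately show ?thesis by (rule finite_imageD)
  qed
  have "B \<subseteq> (\<Union>F\<in>{F. F \<subseteq> N \<and> finite F}. B \<inter> E' F)"
  proof
    fix b assume b: "b \<in> B"
    let ?F = "{\<gamma>\<in>N. f \<gamma> b \<noteq> 0}"
    have "finite {\<gamma>\<in>\<Gamma>. f \<gamma> b \<noteq> 0}" using finite_coordinate_expansion[of b] b B(1) E(2) by blast
    then have "finite ?F" by (rule rev_finite_subset) (use N in auto)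
    then have "?F \<in> {F. F \<subseteq> N \<and> finite F}" by simp
    moreover have "b \<in> B \<inter> E' ?F" using b B(1) by (auto simp: E'_def)
    ultimately show "b \<in> (\<Union>F\<in>{F. F \<subseteq> N \<and> finite F}. B \<inter> E' F)" by (rule UN_I)
  qed
  moreover have "countable (\<Union>F\<in>{F. F \<subseteq> N \<and> finite F}. B \<inter> E' F)"
    using countable_Collect_finite_subset[OF N(1)] fin
    by (intro countable_UN) (auto intro: countable_finite simp: conj_commute)
  ultimately have "countable B" by (rule countable_subset)
  then show ?thesis using separable_space_span_countable[of B] \<open>span B = E\<close> by simp
qed

text \<open>Each \<open>g n\<close> is nonzero at only countably many \<open>x \<gamma>\<close>.
  With \<open>N\<close> the union of these index sets, a vector of \<open>E\<close> whose
  coordinates in \<open>N\<close> vanish is annihilated by every \<open>g n\<close>, hence is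
  0.\<close>

lemma separable_if_countably_many_functionals_separate:
  fixes g :: "nat \<Rightarrow> 'a \<Rightarrow>\<^sub>L real"
  assumes E: "subspace E" "E \<subseteq> span (x ` \<Gamma>)"
    and sep: "\<And>e. e \<in> E \<Longrightarrow> (\<And>n. g n e = 0) \<Longrightarrow> e = 0"
  shows "separable_space (top_of_set E)"
proof -
  define N where "N = (\<Union>n. {\<gamma>\<in>\<Gamma>. g n (x \<gamma>) \<noteq> 0})"
  have "countable N" unfolding N_def using countable_functional_support by blast
  moreover have "N \<subseteq> \<Gamma>" by (auto simp: N_def)
  moreover have "e = 0" if e: "e \<in> E" "\<And>\<gamma>. \<gamma> \<in> N \<Longrightarrow> f \<gamma> e = 0" for e
  proof -
    have e_sum: "e = (\<Sum>\<gamma> | \<gamma> \<in> \<Gamma> \<and> f \<gamma> e \<noteq> 0. f \<gamma> e *\<^sub>R x \<gamma>)"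
      using finite_coordinate_expansion e(1) E(2) by blast
    have "g n e = 0" for n
    proof -
      have "g n e = (\<Sum>\<gamma> | \<gamma> \<in> \<Gamma> \<and> f \<gamma> e \<noteq> 0. f \<gamma> e * g n (x \<gamma>))"
        by (subst e_sum) (simp add: blinfun.sum_right blinfun.scaleR_right)
      also have "\<dots> = 0" using e(2) by (intro sum.neutral) (auto simp: N_def)
      finally show ?thesis .
    qed
    with sep e(1) show ?thesis by blast
  qed
  ultimately show ?thesis
    using E by (intro separable_if_determined_by_countable_coordinates) auto
qed

text \<open>The functionals \<open>g n\<close> composed with the isomorphism are bounded and
  separate the points of \<open>E\<close>. Hahn-Banach extends them to the whole space, where the
  countability of functional supports applies.\<close>

lemma separable_if_isomorphic_to_countably_separated:
  fixes g :: "nat \<Rightarrow> 'b::real_normed_vector \<Rightarrow>\<^sub>L real"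
  assumes E: "subspace E" "E \<subseteq> span (x ` \<Gamma>)" and iso: "linearly_isomorphic E F"
    and sep: "\<And>v. v \<in> F \<Longrightarrow> (\<And>n. g n v = 0) \<Longrightarrow> v = 0"
  shows "separable_space (top_of_set E)"
proof -
  obtain T K where T: "bij_betw T E F"
    and add: "\<And>x y. x \<in> E \<Longrightarrow> y \<in> E \<Longrightarrow> T (x + y) = T x + T y"
    and scale: "\<And>c x. x \<in> E \<Longrightarrow> T (c *\<^sub>R x) = c *\<^sub>R T x"
    and K: "\<And>x. x \<in> E \<Longrightarrow> norm (T x) \<le> K * norm x"
    using iso unfolding linearly_isomorphic_def by metis
  have "\<exists>h :: 'a \<Rightarrow>\<^sub>L real. \<forall>e\<in>E. h e = g n (T e)" for n
  proof -
    have "\<bar>g n (T e)\<bar> \<le> (norm (g n) * K) * norm e" if "e \<in> E" for e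
    proof -
      have "\<bar>g n (T e)\<bar> \<le> norm (g n) * norm (T e)" using norm_blinfun[of "g n" "T e"] by simp
      also have "\<dots> \<le> norm (g n) * (K * norm e)" using K[OF that] by (intro mult_left_mono) auto
      finally show ?thesis by (simp add: mult.assoc)
    qed
    then obtain h :: "'a \<Rightarrow>\<^sub>L real" where "\<And>e. e \<in> E \<Longrightarrow> h e = g n (T e)"
      using Hahn_Banach_extension[OF E(1), of "\<lambda>e. g n (T e)" "norm (g n) * K"]
      by (auto simp: add scale blinfun.add_right blinfun.scaleR_right)
    then show ?thesis by blast
  qed
  then obtain h :: "nat \<Rightarrow> 'a \<Rightarrow>\<^sub>L real" where h: "\<And>n e. e \<in> E \<Longrightarrow> h n e = g n (T e)"
    by metis
  have T0: "T 0 = 0" using scale[of 0 0] subspace_0[OF E(1)] by simp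
  have "e = 0" if "e \<in> E" "\<And>n. h n e = 0" for e
  proof -
    have "T e = 0" using that h sep[of "T e"] T by (auto dest: bij_betwE)
    then show ?thesis
      using T0 T that(1) subspace_0[OF E(1)] by (metis bij_betw_def inj_onD)
  qed
  then show ?thesis by (rule separable_if_countably_many_functionals_separate[OF E])
qed

section \<open>Size of the index set\<close>

lemma uncountable_index:
  assumes "\<not> separable_space (euclidean :: 'a topology)"
  shows "uncountable \<Gamma>"
proof
  assume "countable \<Gamma>"
  then have "separable_space (top_of_set (span (x ` \<Gamma>)))"
    by (intro separable_space_span_countable) auto
  from separable_space_top_of_set_mono_dense[OF this, of UNIV] show False
    using assms fundamental by simp
qed

text \<open>A vector is the limit of a sequence of finite combinations; a coordinate that vanishes
  along the sequence vanishes in the limit.\<close>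

lemma countable_coordinate_support: "countable {\<gamma>\<in>\<Gamma>. f \<gamma> v \<noteq> 0}"
proof -
  obtain s where s: "\<And>n. s n \<in> span (x ` \<Gamma>)" "s \<longlonglongrightarrow> v"
    using fundamental closure_sequential[of v "span (x ` \<Gamma>)"] by auto
  have "{\<gamma>\<in>\<Gamma>. f \<gamma> v \<noteq> 0} \<subseteq> (\<Union>n. {\<gamma>\<in>\<Gamma>. f \<gamma> (s n) \<noteq> 0})"
  proof safe
    fix \<gamma> assume \<gamma>: "\<gamma> \<in> \<Gamma>" "f \<gamma> v \<noteq> 0"
    show "\<gamma> \<in> (\<Union>n. {\<gamma>\<in>\<Gamma>. f \<gamma> (s n) \<noteq> 0})"
    proof (rule ccontr)
      assume "\<gamma> \<notin> (\<Union>n. {\<gamma>\<in>\<Gamma>. f \<gamma> (s n) \<noteq> 0})"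
      then have "f \<gamma> (s n) = 0" for n using \<gamma> by auto
      moreover have "(\<lambda>n. f \<gamma> (s n)) \<longlonglongrightarrow> f \<gamma> v" by (intro blinfun.tendsto tendsto_const s)
      ultimately show False using \<gamma>(2) LIMSEQ_unique[OF tendsto_const] by fastforce
    qed
  qed
  moreover have "countable (\<Union>n. {\<gamma>\<in>\<Gamma>. f \<gamma> (s n) \<noteq> 0})"
    using finite_coordinate_expansion[OF s(1)] by (intro countable_UN) (auto intro: countable_finite)
  ultimately show ?thesis by (rule countable_subset)
qed

text \<open>Since \<open>f \<gamma>\<close> is nonzero at \<open>x \<gamma>\<close>, it is nonzero
  at some point of the dense set \<open>D\<close>. So \<Gamma> is covered by the coordinate supports
  of the points of \<open>D\<close>, each of them countable.\<close>

lemma index_card_le: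
  fixes D :: "'a set"
  assumes D: "closure D = UNIV" "|D| \<le>o |R|" and R: "infinite R"
  shows "|\<Gamma>| \<le>o |R|"
proof -
  have "\<Gamma> \<subseteq> (\<Union>d\<in>D. {\<gamma>\<in>\<Gamma>. f \<gamma> d \<noteq> 0})"
  proof
    fix \<gamma> assume \<gamma>: "\<gamma> \<in> \<Gamma>"
    have "open {v. f \<gamma> v \<noteq> 0}"
      by (intro open_Collect_neq continuous_intros)
    moreover have "x \<gamma> \<in> {v. f \<gamma> v \<noteq> 0}" using f_x[OF \<gamma> \<gamma>] by simp
    ultimately obtain d where "d \<in> D" "f \<gamma> d \<noteq> 0"
      using D(1) open_Int_closure_eq_empty[of "{v. f \<gamma> v \<noteq> 0}" D] by blast
    with \<gamma> show "\<gamma> \<in> (\<Union>d\<in>D. {\<gamma>\<in>\<Gamma>. f \<gamma> d \<noteq> 0})" by blast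
  qed
  then have "|\<Gamma>| \<le>o |\<Union>d\<in>D. {\<gamma>\<in>\<Gamma>. f \<gamma> d \<noteq> 0}|" by (rule card_of_mono1)
  also have "|\<Union>d\<in>D. {\<gamma>\<in>\<Gamma>. f \<gamma> d \<noteq> 0}| \<le>o |R|"
  proof (rule card_of_UNION_ordLeq_infinite[OF R D(2)], rule ballI)
    fix d
    have "|{\<gamma>\<in>\<Gamma>. f \<gamma> d \<noteq> 0}| \<le>o |UNIV :: nat set|"
      using countable_coordinate_support[of d] unfolding countable_def card_of_ordLeq[symmetric]
      by blast
    also have "|UNIV :: nat set| \<le>o |R|" using R infinite_iff_card_of_nat by blast
    finally show "|{\<gamma>\<in>\<Gamma>. f \<gamma> d \<noteq> 0}| \<le>o |R|" .
  qed
  finally show ?thesis .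
qed

section \<open>A dense subspace separated by countably many coordinates\<close>

text \<open>The series of the vectors \<open>x (e n)\<close>, normalized and weighted by the terms
  of the exponential series, converges absolutely for every \<open>t\<close>; continuity and
  biorthogonality give the coordinates of its sum.\<close>

lemma exponential_vector:
  assumes e: "inj e" "range e \<subseteq> \<Gamma>"
  obtains u where "\<And>m. f (e m) u = t ^ m / (fact m * norm (x (e m)))"
proof -
  define w where "w n = (t ^ n / (fact n * norm (x (e n)))) *\<^sub>R x (e n)" for n
  have "norm (w n) = norm (t ^ n / fact n)" for n
    using x_nonzero[of "e n"] e(2) by (auto simp: w_def)
  then have "summable (\<lambda>n. norm (w n))"
    using summable_norm_exp[of t] by (simp add: divide_inverse_commute)
  then have "summable w" by (rule summable_norm_cancel)
  have "f (e m) (suminf w) = t ^ m / (fact m * norm (x (e m)))" for m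
  proof -
    have "(\<lambda>n. f (e m) (w n)) sums f (e m) (suminf w)"
      by (intro bounded_linear.sums[OF blinfun.bounded_linear_right] summable_sums \<open>summable w\<close>)
    moreover have "(\<lambda>n. f (e m) (w n)) = (\<lambda>n. if n = m then t ^ n / (fact n * norm (x (e n))) else 0)"
    proof
      fix n
      have "f (e m) (x (e n)) = (if n = m then 1 else 0)"
        using f_x[of "e m" "e n"] range_subsetD[OF e(2)] e(1) by (auto simp: inj_eq)
      then show "f (e m) (w n) = (if n = m then t ^ n / (fact n * norm (x (e n))) else 0)"
        by (simp add: w_def blinfun.scaleR_right)
    qed
    ultimately show ?thesis
      using sums_single[of m "\<lambda>n. t ^ n / (fact n * norm (x (e n)))"] sums_unique2 by metis
  qed
  then show thesis by (rule that)
qed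

text \<open>The perturbed vectors \<open>z (\<gamma>, k)\<close> tend to \<open>x \<gamma>\<close>
  as \<open>k\<close> grows, which gives density. Each pair has its own parameter
  \<open>\<mu> p\<close>, so in a finite combination the far coordinates along \<open>e\<close> form
  a Vandermonde system that determines all coefficients.\<close>

theorem dense_countably_separated_subspace:
  assumes "infinite \<Gamma>" "|\<Gamma>| \<le>o |UNIV :: real set|"
  obtains Z and g :: "nat \<Rightarrow> 'a \<Rightarrow>\<^sub>L real" where "subspace Z" "closure Z = UNIV"
    "\<And>v. v \<in> Z \<Longrightarrow> (\<And>n. g n v = 0) \<Longrightarrow> v = 0"
proof -
  obtain e :: "nat \<Rightarrow> 'i" where e: "inj e" "range e \<subseteq> \<Gamma>"
    using infinite_countable_subset[OF assms(1)] by blast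
  have "|\<Gamma> \<times> (UNIV :: nat set)| \<le>o |UNIV :: real set|"
    using infinite_UNIV_char_0[where 'a = real] assms(2)
    by (rule card_of_Sigma_ordLeq_infinite)
      (simp add: infinite_iff_card_of_nat[symmetric] infinite_UNIV_char_0)
  then obtain h :: "'i \<times> nat \<Rightarrow> real" where h: "inj_on h (\<Gamma> \<times> UNIV)"
    unfolding card_of_ordLeq[symmetric] by blast
  \<comment> \<open>The exponential keeps the parameters distinct and makes them nonzero, as the
    Vandermonde lemma requires.\<close>
  define \<mu> where "\<mu> p = exp (h p)" for p
  have \<mu>: "inj_on \<mu> (\<Gamma> \<times> UNIV)" using h by (auto simp: \<mu>_def inj_on_def)
  have "\<exists>u. \<forall>m. f (e m) u = t ^ m / (fact m * norm (x (e m)))" for t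
    by (rule exponential_vector[OF e, of t]) blast
  then obtain u where u: "\<And>t m. f (e m) (u t) = t ^ m / (fact m * norm (x (e m)))"
    by metis
  \<comment> \<open>The scaling is positive and bounds the perturbation of \<open>x \<gamma>\<close>
    in \<open>z (\<gamma>, k)\<close> by \<open>1 / (k + 1)\<close>, whatever the norm of
    \<open>u (\<mu> p)\<close>.\<close>
  define a where "a p = inverse (real (Suc (snd p))) / (1 + norm (u (\<mu> p)))" for p
  have "1 + norm (u (\<mu> p)) > 0" for p by (simp add: add_pos_nonneg)
  then have a_pos: "a p > 0" for p by (simp add: a_def)
  define z where "z p = x (fst p) + a p *\<^sub>R u (\<mu> p)" for p
  define Z where "Z = span (z ` (\<Gamma> \<times> UNIV))"
  have "x \<gamma> \<in> closure Z" if "\<gamma> \<in> \<Gamma>" for \<gamma>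
  proof -
    have "norm (a (\<gamma>, k) *\<^sub>R u (\<mu> (\<gamma>, k))) \<le> inverse (real (Suc k))" for k
    proof -
      define b where "b = norm (u (\<mu> (\<gamma>, k)))"
      have "b \<ge> 0" by (simp add: b_def)
      then have "b / (1 + b) \<le> 1" by simp
      then have "inverse (real (Suc k)) * (b / (1 + b)) \<le> inverse (real (Suc k)) * 1"
        by (intro mult_left_mono) auto
      moreover have "norm (a (\<gamma>, k) *\<^sub>R u (\<mu> (\<gamma>, k))) = a (\<gamma>, k) * b"
        using a_pos[of "(\<gamma>, k)"] by (simp add: b_def)
      ultimately show ?thesis by (simp add: a_def b_def)
    qed
    then have "(\<lambda>k. a (\<gamma>, k) *\<^sub>R u (\<mu> (\<gamma>, k))) \<longlonglongrightarrow> 0"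
      by (intro Lim_null_comparison[OF _ LIMSEQ_inverse_real_of_nat] always_eventually allI)
    then have "(\<lambda>k. z (\<gamma>, k)) \<longlonglongrightarrow> x \<gamma>"
      using tendsto_add[OF tendsto_const[of "x \<gamma>"]] unfolding z_def fst_conv by fastforce
    moreover have "z (\<gamma>, k) \<in> Z" for k
      unfolding Z_def using that by (intro span_base imageI) simp
    ultimately show ?thesis
      unfolding closure_sequential by (intro exI[of _ "\<lambda>k. z (\<gamma>, k)"]) simp
  qed
  then have "span (x ` \<Gamma>) \<subseteq> closure Z"
    unfolding Z_def by (intro span_minimal subspace_closure subspace_span image_subsetI)
  then have dense: "closure Z = UNIV"
    using fundamental closure_minimal[of "span (x ` \<Gamma>)" "closure Z"] by auto
  have sep: "v = 0" if v: "v \<in> Z" "\<And>n. f (e n) v = 0" for v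
  proof -
    obtain I c where I: "finite I" "I \<subseteq> \<Gamma> \<times> UNIV" and v_sum: "v = (\<Sum>p\<in>I. c p *\<^sub>R z p)"
      using v(1) unfolding Z_def by (rule span_image_explicit)
    \<comment> \<open>The unperturbed part \<open>x (fst p)\<close> affects only the coordinate
      \<open>fst p\<close>. Beyond \<open>N\<close> no such index occurs, and the coordinates along
      \<open>e\<close> see only the vectors \<open>u (\<mu> p)\<close>.\<close>
    have "finite (e -` (fst ` I))" using I(1) e(1) by (intro finite_vimageI finite_imageI)
    then obtain N where N: "\<And>n. n \<ge> N \<Longrightarrow> e n \<notin> fst ` I"
      unfolding finite_nat_set_iff_bounded by (auto simp: not_le[symmetric])
    have "(\<Sum>p\<in>I. c p * a p * \<mu> p ^ n) = 0" if "n \<ge> N" for n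
    proof -
      have "f (e n) (z p) = a p * \<mu> p ^ n / (fact n * norm (x (e n)))"
        if "p \<in> I" for p
      proof -
        have "fst p \<in> fst ` I" using \<open>p \<in> I\<close> by (rule imageI)
        then have "fst p \<noteq> e n" using N[OF \<open>n \<ge> N\<close>] by metis
        moreover have "fst p \<in> \<Gamma>" using subsetD[OF I(2) \<open>p \<in> I\<close>] by (simp add: mem_Times_iff)
        moreover have "e n \<in> \<Gamma>" using e(2) by auto
        ultimately have "f (e n) (x (fst p)) = 0" by (simp add: f_x)
        then show ?thesis by (simp add: z_def u blinfun.add_right blinfun.scaleR_right)
      qed
      then have "0 = (\<Sum>p\<in>I. c p * (a p * \<mu> p ^ n / (fact n * norm (x (e n)))))"
        using v(2)[of n] by (simp add: v_sum blinfun.sum_right blinfun.scaleR_right)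
      \<comment> \<open>The factor depending on \<open>n\<close> alone is common to all terms and
        nonzero.\<close>
      also have "\<dots> = (\<Sum>p\<in>I. c p * a p * \<mu> p ^ n) / (fact n * norm (x (e n)))"
        unfolding sum_divide_distrib by (intro sum.cong) (simp_all add: mult.assoc)
      finally show ?thesis using x_nonzero[of "e n"] e(2) by auto
    qed
    moreover have "inj_on \<mu> I" using \<mu> I(2) by (rule inj_on_subset)
    ultimately have "c p * a p = 0" if "p \<in> I" for p
      using vandermonde_injective[of I \<mu> N "\<lambda>p. c p * a p" p] I(1) that
      by (simp add: \<mu>_def)
    then have "c p = 0" if "p \<in> I" for p using a_pos[of p] that by fastforce
    then show ?thesis by (simp add: v_sum)
  qed
  have "subspace Z" unfolding Z_def by (rule subspace_span)
  then show thesis using dense sep by (rule that[of Z "\<lambda>n. f (e n)"])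
qed

end

section \<open>Density character and the two subspaces\<close>

lemma dense_in_euclidean_iff: "dense_in_topology euclidean D \<longleftrightarrow> closure D = UNIV"
  by (simp add: dense_in_topology_def)

lemma not_separable_if_density_character_uncountable:
  assumes "cardSuc natLeq \<le>o density_character (euclidean :: 'a::topological_space topology)"
  shows "\<not> separable_space (euclidean :: 'a topology)"
proof
  assume "separable_space (euclidean :: 'a topology)"
  then obtain C :: "'a set" where C: "countable C" "dense_in_topology euclidean C"
    by (auto simp: separable_space_def dense_in_topology_def)
  have "density_character (euclidean :: 'a topology) \<le>o |C|"
    using density_character_witness[of "euclidean :: 'a topology"] C(2) by metis
  also have "|C| \<le>o |UNIV :: nat set|"
    using C(1) unfolding countable_def card_of_ordLeq[symmetric] by blast
  also have "|UNIV :: nat set| =o natLeq" by (rule card_of_nat)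
  finally have "cardSuc natLeq \<le>o natLeq" using assms ordLeq_transitive by blast
  then show False
    using cardSuc_greater[OF natLeq_Card_order] not_ordLess_ordLeq by blast
qed

theorem theorem3p3:
  assumes "weakly_Lindelof_determined TYPE('a::banach)"
    and "cardSuc natLeq \<le>o density_character (euclidean :: 'a topology)"
    and "density_character (euclidean :: 'a topology) \<le>o |UNIV :: real set|"
  shows "\<exists>(Y :: 'a set) (Z :: 'a set).
    subspace Y \<and> closure Y = UNIV \<and> subspace Z \<and> closure Z = UNIV
    \<and> (\<forall>E F. subspace E \<and> E \<subseteq> Y \<and> \<not> separable_space (top_of_set E)
          \<and> subspace F \<and> F \<subseteq> Z \<longrightarrow> \<not> linearly_isomorphic E F)
    \<and> (\<forall>E F. subspace E \<and> E \<subseteq> Z \<and> \<not> separable_space (top_of_set E)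
          \<and> subspace F \<and> F \<subseteq> Y \<longrightarrow> \<not> linearly_isomorphic E F)
    \<and> \<not> densely_isomorphic Y Z"
proof -
  obtain \<Gamma> :: "'a set" and x f where "M_basis \<Gamma> x f"
    and "\<And>g :: 'a \<Rightarrow>\<^sub>L real. countable {\<gamma>\<in>\<Gamma>. blinfun_apply g (x \<gamma>) \<noteq> 0}"
    using assms(1) unfolding weakly_Lindelof_determined_def by blast
  then interpret weakly_Lindelof_system \<Gamma> x f
    by unfold_locales (simp_all add: M_basis_def)
  have nonsep: "\<not> separable_space (euclidean :: 'a topology)"
    using assms(2) by (rule not_separable_if_density_character_uncountable)
  obtain D :: "'a set" where "closure D = UNIV" "|D| \<le>o |UNIV :: real set|"
    using density_character_witness[of "euclidean :: 'a topology"] assms(3)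
    by (metis dense_in_euclidean_iff)
  then have "|\<Gamma>| \<le>o |UNIV :: real set|"
    by (rule index_card_le) (rule infinite_UNIV_char_0)
  moreover have "infinite \<Gamma>" using uncountable_index[OF nonsep] by (rule uncountable_infinite)
  ultimately obtain Z and g :: "nat \<Rightarrow> 'a \<Rightarrow>\<^sub>L real" where Z: "subspace Z" "closure Z = UNIV"
    and sep: "\<And>v. v \<in> Z \<Longrightarrow> (\<And>n. g n v = 0) \<Longrightarrow> v = 0"
    using dense_countably_separated_subspace by blast
  define Y where "Y = span (x ` \<Gamma>)"
  have YZ: "separable_space (top_of_set E)"
    if "subspace E" "E \<subseteq> Y" "F \<subseteq> Z" "linearly_isomorphic E F" for E F
  proof (rule separable_if_isomorphic_to_countably_separated[OF that(1) _ that(4)])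
    show "E \<subseteq> span (x ` \<Gamma>)" using that(2) by (simp add: Y_def)
    show "v = 0" if "v \<in> F" "\<And>n. g n v = 0" for v
      using sep[OF _ that(2)] that(1) \<open>F \<subseteq> Z\<close> by blast
  qed
  have ZY: "separable_space (top_of_set E)"
    if "subspace E" "E \<subseteq> Z" "subspace F" "F \<subseteq> Y" "linearly_isomorphic E F" for E F
  proof -
    \<comment> \<open>Only subspaces of \<open>Y\<close> are known to be separable, so the
      isomorphism is inverted to treat \<open>F\<close>, and separability is then carried back to
      \<open>E\<close>.\<close>
    have FE: "linearly_isomorphic F E" using that(1,5) by (rule linearly_isomorphic_sym)
    have "separable_space (top_of_set F)" using YZ that FE by blast
    with FE that(3) show ?thesis by (intro separable_space_linearly_isomorphic[of F E])
  qed
  have "\<not> densely_isomorphic Y Z"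
  proof
    assume "densely_isomorphic Y Z"
    then obtain Y0 Z0 where 0: "subspace Y0" "dense_in_topology (top_of_set Y) Y0"
      "dense_in_topology (top_of_set Z) Z0" "linearly_isomorphic Y0 Z0"
      unfolding densely_isomorphic_def by blast
    then have sub: "Y0 \<subseteq> Y" "Z0 \<subseteq> Z" by (auto simp: dense_in_topology_def)
    \<comment> \<open>A dense subspace of \<open>Y\<close> is dense in the whole space. Were
      \<open>Y0\<close> isomorphic to a subspace of \<open>Z\<close>, it would be separable, and so
      would the whole space.\<close>
    have "Y \<subseteq> closure Y0"
      using 0(2) sub(1) by (auto simp: dense_in_topology_def closure_of_subtopology Int_absorb1)
    then have "closure Y0 = UNIV"
      using fundamental closure_minimal[of Y "closure Y0"] by (auto simp: Y_def)
    moreover have "separable_space (top_of_set Y0)" using YZ 0 sub by blast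
    ultimately show False
      using separable_space_top_of_set_mono_dense[of Y0 UNIV] nonsep by simp
  qed
  then show ?thesis
    using Z YZ ZY fundamental
    by (intro exI[of _ Y] exI[of _ Z]) (auto simp: Y_def)
qed

end
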